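(* Let $A$ be a threshold automaton with counter system $CS(A)$ and $(0,1)$-counter system $ZCS(\overline A)=(\Sigma^z,\Sigma^z_0,\mathcal T^z)$, let $L_{spec}=(L_{=0},L_{>0})$ be a reachability specification (describing error configurations), and let $ERR=\{\sigma^z\in\Sigma^z\mid\sigma^z\models L_{spec}\}$. The Parameterized Reachability Checking algorithm PRA (described in the context), run on $ZCS(\overline A)$ and $ERR$, is sound and complete: it computes a non-spurious error path if and only if $CS(A)$ includes a reachable configuration $\sigma$ with $\sigma.\mathbf k[i]=0$ for all $i\in L_{=0}$ and $\sigma.\mathbf k[i]>0$ for all $i\in L_{>0}$.
   Context: **Threshold automaton.** A threshold automaton is $A=(L,\mathcal I,\Gamma,\Pi,\mathcal R,RC)$, where: $L$ is a finite set of locations; $\mathcal I\subseteq L$ is the set of initial locations; $\Gamma=\{x_0,\dots,x_m\}$ is a finite set of shared variables over $\mathbb N_0$; $\Pi$ is a finite set of parameter variables over $\mathbb N_0$; $RC$ (resilience condition) is a linear integer arithmetic formula over $\Pi$, and $\mathbf P_{RC}=\{\mathbf p\in\mathbb N_0^{|\Pi|}:\mathbf p\models RC\}$ is the set of admissible parameter vectors; $\mathcal R$ is a finite set of rules $r=(from,to,\varphi,\mathbf{uv},\tau)$ with $from,to\in L$, update vector $\mathbf{uv}\in\mathbb Z^{|\Gamma|}$ with entries in $\{-1,0,1\}$, $\tau\subseteq\Gamma$ the set of variables reset to $0$, and guard $\varphi$ a conjunction of lower guards $a_0+\sum_i a_ip_i\le x$ and upper guards $a_0+\sum_i a_ip_i>x$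 ($x\in\Gamma$, $p_i\in\Pi$, $a_i\in\mathbb Q$). The left-hand side of a guard is called a threshold. A function $N:\mathbf P_{RC}\to\mathbb N_0$, given by a linear expression in the parameters, gives the number of modelled processes. **Counter system $CS(A)=(\Sigma,\Sigma_0,\mathcal T)$.** $\Sigma$ is the set of configurations $\sigma=(\mathbf k,\mathbf g,\mathbf p)$ with $\mathbf k\in\mathbb N_0^{|L|}$, $\mathbf g\in\mathbb N_0^{|\Gamma|}$, $\mathbf p\in\mathbf P_{RC}$. $\Sigma_0$: all $\sigma$ with $\mathbf g=0$, $\sum_{i\in\mathcal I}\mathbf k[i]=N(\mathbf p)$, $\sum_{i\notin\mathcal I}\mathbf k[i]=0$. $(\sigma,r,\sigma')\in\mathcal T$ iff $\sigma'.\mathbf p=\sigma.\mathbf p$; one process moves from $r.from$ to $r.to$ (i.e. $\sigma.\mathbf k[r.from]\ge1$ and $\sigma'.\mathbf k=\sigma.\mathbf k-\mathbf u_{r.from}+\mathbf u_{r.to}$, $\mathbf u_i$ the $i$-th unit vector); $\sigma.\mathbf g$ (with $\sigma.\mathbf p$) satisfies $r.\varphi$; and $\sigma'.\mathbf g[i]=0$ if $x_i\in r.\tau$, $\sigma'.\mathbf g[i]=\sigma.\mathbf g[i]+r.\mathbf{uv}[i]$ otherwise. A path of $CS(A)$ is a finite alternating sequence $\sigma_0,r_0,\sigma_1,\dots,r_{k-1},\sigma_k$ with $\sigma_0\in\Sigma_0$ and $(\sigma_i,r_i,\sigma_{i+1})\in\mathcal T$; reachable means occurring on such a path. **Abstract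 threshold automaton.** Let $\{d_0,\dots,d_k\}$ with $d_0=0$, $d_1=1$ and $d_i$ ($i>1$) the thresholds of $A$, indexed so that $d_i<d_j$ whenever $i<j$ (different admissible parameters inducing different orders are treated as separate cases, so one order is fixed). Let $\mathcal D=\{I_0,\dots,I_k\}$ with $I_i=[d_i,d_{i+1}[$ for $i<k$ and $I_k=[d_k,\infty[$. $\overline A=(L,\mathcal I,\overline\Gamma,\Pi,\overline{\mathcal R})$ has variables $\overline x_i$ over $\mathcal D$ and abstract rules $\overline r=(from,to,\overline\varphi,\mathbf{uv},\tau)$, where $\overline\varphi$ is obtained from $\varphi$ by replacing each conjunct $d_j\le x$ by $\bigvee_{c\ge j}(\overline x=I_c)$ and each conjunct $d_j>x$ by $\bigvee_{c<j}(\overline x=I_c)$. **$(0,1)$-counter system.** $ZCS(\overline A)=(\Sigma^z,\Sigma^z_0,\mathcal T^z)$, where $\Sigma^z=\{0,1\}^{|L|}\times\mathcal D^{|\Gamma|}$ is the set of $(0,1)$-configurations $\sigma^z=(\mathbf k^z,\overline{\mathbf g})$; $\Sigma^z_0$ consists of those with all $\overline{\mathbf g}[i]=I_0$ and $\mathbf k^z[i]=1\Rightarrow i\in\mathcal I$; and $(\sigma^z,\overline r,\sigma^{z\prime})\in\mathcal T^z$ iff $\sigma^z.\overline{\mathbf g}\models\overline r.\overline\varphi$, $\sigma^z.\mathbf k^z[\overline r.from]=1$, $\sigma^{z\prime}.\mathbf k^z[\overline r.from]\in\{0,1\}$, $\sigma^{z\prime}.\mathbf k^z[\overline r.to]=1$,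 all other entries of $\mathbf k^z$ are unchanged, and for each $i$: if $x_i\in\overline r.\tau$ the new interval is $I_0$; otherwise, if $\mathbf{uv}[i]=0$ it is unchanged; if $\mathbf{uv}[i]=1$ it is unchanged or the next interval (it must be the next one if the old interval is $I_0$; $I_k$ has no next); if $\mathbf{uv}[i]=-1$ it is unchanged or the previous interval (unchanged if it is $I_0$). Paths of $ZCS(\overline A)$ start in $\Sigma^z_0$. $\sigma^z\models L_{spec}$ means $\mathbf k^z[i]=0$ for all $i\in L_{=0}$ and $\mathbf k^z[i]=1$ for all $i\in L_{>0}$ (with $L_{=0},L_{>0}\subseteq L$). **Non-spurious (for reachability).** A path $\pi^z=\sigma^z_0,\overline r_0,\dots,\overline r_{m-1},\sigma^z_m$ of $ZCS(\overline A)$ is non-spurious if $Concretize(\pi^z)\wedge Reach(\pi^z)$ is satisfiable, i.e. if there is a path of $CS(A)$ of the form $\sigma_0,r_0^{c_0},\sigma_1,\dots,r_{m-1}^{c_{m-1}},\sigma_m$ (where $r_i^{c_i}$ means applying $r_i$ consecutively $c_i\in\mathbb N_0$ times, $r_i$ being the concrete rule of $\overline r_i$) such that for all $i<m$: $\sigma_i.\mathbf k[r_i.from]=c_i+\sigma_{i+1}.\mathbf k[r_i.from]$ and $\sigma_{i+1}.\mathbf k[r_i.to]=c_i+\sigma_i.\mathbf k[r_i.to]$ when $r_i.from\ne r_i.to$; $\sigma_{i+1}.\mathbf g[j]=\sigma_i.\mathbf g[j]+c_i\,r_i.\mathbf{uv}[j]$ for $x_j\notin r_i.\tau$; $\sigma_{i+1}.\mathbf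 g[j]=0$ for $x_j\in r_i.\tau$; if $c_i>1$ then $\sigma_{i+1}.\mathbf g-r_i.\mathbf{uv}\models r_i.\varphi$; moreover $\sigma_i.\mathbf g[j]\in\sigma^z_i.\overline{\mathbf g}[j]$ for all $i\le m$ and all $j$, and ($Reach$) for all $l\in L$: $\sigma_m.\mathbf k[l]>0\Leftrightarrow\sigma^z_m.\mathbf k^z[l]>0$. **The algorithm PRA.** Set $E_0=ERR$, $visitedTrans=\emptyset$. For $i=1,2,\dots$ while $E_{i-1}\ne\emptyset$: add all $(\sigma^z,\overline r,\sigma^{z\prime})\in\mathcal T^z$ with $\sigma^{z\prime}\in E_{i-1}$ to $visitedTrans$, and let $E_i$ be the set of their source configurations that do not already occur in some $E_j$, $j<i$. When the loop ends, if no $E_j$ meets $\Sigma^z_0$, answer "safe". Otherwise build the error graph consisting of all transitions in $visitedTrans$ reachable from $\bigcup_jE_j\cap\Sigma_0^z$, enumerate in breadth-first order, by unfolding, its paths from $\Sigma^z_0$ to $ERR$ (error paths), test each for non-spuriousness, and return a non-spurious one as soon as it is found; if all are spurious, answer "safe".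
   Formalization: Thresholds are ordered by their values rounded up to natural numbers, and those with equal rounded values for all admissible parameters are identified; with rational values (e.g. 6/5, 3/2) an interval may contain no natural number and the claim fails. *)

theory Defs
  imports Complex_Main "HOL-Library.While_Combinator"
begin

section \<open>Linear expressions and resilience conditions\<close>

text \<open>Locations, shared variables and parameters are the elements of finite types
  \<open>'l\<close>, \<open>'x\<close>, \<open>'p\<close>.\<close>

datatype ('a, 'p) linexp = LinExp (const: 'a) (coeff: "'p \<Rightarrow> 'a")

definition lin_eval :: "('a::comm_semiring_1, 'p::finite) linexp \<Rightarrow> ('p \<Rightarrow> nat) \<Rightarrow> 'a" where
  "lin_eval e p = const e + (\<Sum>i\<in>UNIV. coeff e i * of_nat (p i))"

text \<open>Divisibility atoms are included so that quantifier-free formulas already have the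
  full expressive power of linear integer (Presburger) arithmetic.\<close>

datatype 'p lia =
    Le "(int, 'p) linexp" "(int, 'p) linexp"
  | Dvd int "(int, 'p) linexp"
  | Neg "'p lia"
  | Conj "'p lia" "'p lia"

primrec lia_sat :: "('p::finite \<Rightarrow> nat) \<Rightarrow> 'p lia \<Rightarrow> bool" where
  "lia_sat p (Le e f) \<longleftrightarrow> lin_eval e p \<le> lin_eval f p"
| "lia_sat p (Dvd m e) \<longleftrightarrow> m dvd lin_eval e p"
| "lia_sat p (Neg F) \<longleftrightarrow> \<not> lia_sat p F"
| "lia_sat p (Conj F G) \<longleftrightarrow> lia_sat p F \<and> lia_sat p G"


section \<open>Threshold automata\<close>

type_synonym 'p threshold = "(rat, 'p) linexp"

datatype ('x, 'p) atomic_guard =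
    Lower (thr: "'p threshold") (var: 'x)   \<comment> \<open>threshold \<open>\<le> x\<close>\<close>
  | Upper (thr: "'p threshold") (var: 'x)   \<comment> \<open>threshold \<open>> x\<close>\<close>

text \<open>A guard is the conjunction of the listed atomic guards.\<close>

record ('l, 'x, 'p) rule =
  from_loc :: 'l
  to_loc :: 'l
  guard :: "('x, 'p) atomic_guard list"
  upd :: "'x \<Rightarrow> int"
  reset :: "'x set"

record ('l, 'x, 'p) ta =
  initial_locs :: "'l set"
  rules :: "('l, 'x, 'p) rule set"
  RC :: "'p lia"
  procs :: "(rat, 'p) linexp"   \<comment> \<open>the number \<open>N\<close> of processes\<close>

definition params :: "('l, 'x, 'p::finite) ta \<Rightarrow> ('p \<Rightarrow> nat) set" where
  "params A = {p. lia_sat p (RC A)}"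

definition threshold_automaton :: "('l::finite, 'x::finite, 'p::finite) ta \<Rightarrow> bool" where
  "threshold_automaton A \<longleftrightarrow>
     finite (rules A) \<and>
     (\<forall>r\<in>rules A. \<forall>x. upd r x \<in> {-1, 0, 1}) \<and>
     (\<forall>p\<in>params A. lin_eval (procs A) p \<in> \<nat>)"

text \<open>Guards are evaluated on integer valuations, since the condition on accelerated
  transitions below evaluates a guard on a difference of vectors.\<close>

fun atom_sat :: "('x \<Rightarrow> int) \<Rightarrow> ('p::finite \<Rightarrow> nat) \<Rightarrow> ('x, 'p) atomic_guard \<Rightarrow> bool" where
  "atom_sat g p (Lower t x) \<longleftrightarrow> lin_eval t p \<le> of_int (g x)"
| "atom_sat g p (Upper t x) \<longleftrightarrow> lin_eval t p > of_int (g x)"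

definition guard_sat ::
    "('x \<Rightarrow> int) \<Rightarrow> ('p::finite \<Rightarrow> nat) \<Rightarrow> ('x, 'p) atomic_guard list \<Rightarrow> bool" where
  "guard_sat g p \<phi> \<longleftrightarrow> (\<forall>a\<in>set \<phi>. atom_sat g p a)"


section \<open>Paths of labelled transition systems\<close>

text \<open>The alternating sequence \<open>s\<^sub>0, r\<^sub>0, s\<^sub>1, \<dots>, r\<^sub>m\<^sub>-\<^sub>1, s\<^sub>m\<close> is represented by the pair of the
  list of states (of length \<open>m + 1\<close>) and the list of labels (of length \<open>m\<close>).\<close>

type_synonym ('s, 'r) path = "'s list \<times> 'r list"

definition is_path :: "'s set \<Rightarrow> ('s \<times> 'r \<times> 's) set \<Rightarrow> ('s, 'r) path \<Rightarrow> bool" where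
  "is_path S0 T = (\<lambda>(ss, rs).
     length ss = Suc (length rs) \<and> ss ! 0 \<in> S0 \<and>
     (\<forall>i<length rs. (ss ! i, rs ! i, ss ! Suc i) \<in> T))"


section \<open>The counter system\<close>

record ('l, 'x, 'p) config =
  kc :: "'l \<Rightarrow> nat"
  gc :: "'x \<Rightarrow> nat"
  par :: "'p \<Rightarrow> nat"

definition configs :: "('l, 'x, 'p::finite) ta \<Rightarrow> ('l, 'x, 'p) config set" where
  "configs A = {\<sigma>. par \<sigma> \<in> params A}"

definition cs_init :: "('l::finite, 'x, 'p::finite) ta \<Rightarrow> ('l, 'x, 'p) config set" where
  "cs_init A = {\<sigma> \<in> configs A.
     (\<forall>x. gc \<sigma> x = 0) \<and>
     of_nat (\<Sum>l\<in>initial_locs A. kc \<sigma> l) = lin_eval (procs A) (par \<sigma>) \<and>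
     (\<Sum>l\<in>-initial_locs A. kc \<sigma> l) = 0}"

definition cs_trans :: "('l, 'x, 'p::finite) ta \<Rightarrow>
    (('l, 'x, 'p) config \<times> ('l, 'x, 'p) rule \<times> ('l, 'x, 'p) config) set" where
  "cs_trans A = {(\<sigma>, r, \<sigma>').
     \<sigma> \<in> configs A \<and> r \<in> rules A \<and> \<sigma>' \<in> configs A \<and>
     par \<sigma>' = par \<sigma> \<and>
     kc \<sigma> (from_loc r) \<ge> 1 \<and>
     (\<forall>l. int (kc \<sigma>' l) = int (kc \<sigma> l) - of_bool (l = from_loc r) + of_bool (l = to_loc r)) \<and>
     guard_sat (\<lambda>x. int (gc \<sigma> x)) (par \<sigma>) (guard r) \<and>
     (\<forall>x. if x \<in> reset r then gc \<sigma>' x = 0 else int (gc \<sigma>' x) = int (gc \<sigma> x) + upd r x)}"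

definition cs_path ::
    "('l::finite, 'x, 'p::finite) ta \<Rightarrow> (('l, 'x, 'p) config, ('l, 'x, 'p) rule) path \<Rightarrow> bool" where
  "cs_path A = is_path (cs_init A) (cs_trans A)"

definition reachable :: "('l::finite, 'x, 'p::finite) ta \<Rightarrow> ('l, 'x, 'p) config \<Rightarrow> bool" where
  "reachable A \<sigma> \<longleftrightarrow> (\<exists>\<pi>. cs_path A \<pi> \<and> \<sigma> \<in> set (fst \<pi>))"


section \<open>The abstract threshold automaton\<close>

definition thresholds :: "('l, 'x, 'p) ta \<Rightarrow> 'p threshold set" where
  "thresholds A = (\<Union>r\<in>rules A. thr ` set (guard r))"

text \<open>Shared variables are natural numbers, so a threshold with rational value \<open>v\<close> separates them
  at \<open>nat \<lceil>v\<rceil>\<close>: for natural \<open>n\<close>, \<open>v \<le> n\<close> iff \<open>nat \<lceil>v\<rceil> \<le> n\<close>. The order of thresholds is the order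
  of these cut points, and thresholds with the same cut point for all admissible parameters are
  identified. (For positive integer-valued thresholds this is the order of their values.)
  Ordering the rational values instead would allow intervals without natural numbers, such as
  \<open>[6/5, 3/2[\<close>; an increment then jumps over an interval, which the abstract increment
  (to the same or the next interval) cannot follow.\<close>

definition cut :: "'p::finite threshold \<Rightarrow> ('p \<Rightarrow> nat) \<Rightarrow> nat" where
  "cut t p = nat \<lceil>lin_eval t p\<rceil>"

text \<open>\<open>ds\<close> lists \<open>d\<^sub>0, \<dots>, d\<^sub>k\<close>, with the same strict order for all admissible parameters.\<close>

definition threshold_order :: "('l, 'x, 'p::finite) ta \<Rightarrow> 'p threshold list \<Rightarrow> bool" where
  "threshold_order A ds \<longleftrightarrow>
     length ds \<ge> 2 \<and> ds ! 0 = LinExp 0 (\<lambda>_. 0) \<and> ds ! 1 = LinExp 1 (\<lambda>_. 0) \<and>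
     set (drop 2 ds) \<subseteq> thresholds A \<and>
     (\<forall>t\<in>thresholds A. \<exists>j<length ds. \<forall>p\<in>params A. cut t p = cut (ds ! j) p) \<and>
     (\<forall>p\<in>params A. \<forall>i j. i < j \<and> j < length ds \<longrightarrow> cut (ds ! i) p < cut (ds ! j) p)"

definition thr_index :: "('l, 'x, 'p::finite) ta \<Rightarrow> 'p threshold list \<Rightarrow> 'p threshold \<Rightarrow> nat" where
  "thr_index A ds t = (LEAST j. j < length ds \<and> (\<forall>p\<in>params A. cut t p = cut (ds ! j) p))"

text \<open>The abstract value \<open>I\<^sub>c\<close> is represented by its index \<open>c \<le> k\<close>, where \<open>k = length ds - 1\<close>.
  The bounds of the interval depend on the parameters.\<close>

definition in_interval :: "'p::finite threshold list \<Rightarrow> ('p \<Rightarrow> nat) \<Rightarrow> nat \<Rightarrow> nat \<Rightarrow> bool" where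
  "in_interval ds p c n \<longleftrightarrow>
     c < length ds \<and> lin_eval (ds ! c) p \<le> of_nat n \<and>
     (Suc c < length ds \<longrightarrow> of_nat n < lin_eval (ds ! Suc c) p)"

text \<open>The abstract atomic guard \<open>(x, C)\<close> is the disjunction, over \<open>c \<in> C\<close>, of \<open>x = I\<^sub>c\<close>.\<close>

record ('l, 'x) abs_rule =
  afrom :: 'l
  ato :: 'l
  aguard :: "('x \<times> nat set) list"
  aupd :: "'x \<Rightarrow> int"
  areset :: "'x set"

record ('l, 'x) abs_ta =
  ainitial :: "'l set"
  arules :: "('l, 'x) abs_rule set"
  atop :: nat   \<comment> \<open>the index \<open>k\<close> of the last interval\<close>

fun abs_atom ::
    "('l, 'x, 'p::finite) ta \<Rightarrow> 'p threshold list \<Rightarrow> ('x, 'p) atomic_guard \<Rightarrow> 'x \<times> nat set" where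
  "abs_atom A ds (Lower t x) = (x, {c. c < length ds \<and> c \<ge> thr_index A ds t})"
| "abs_atom A ds (Upper t x) = (x, {c. c < length ds \<and> c < thr_index A ds t})"

definition abs_of_rule ::
    "('l, 'x, 'p::finite) ta \<Rightarrow> 'p threshold list \<Rightarrow> ('l, 'x, 'p) rule \<Rightarrow> ('l, 'x) abs_rule" where
  "abs_of_rule A ds r =
     \<lparr>afrom = from_loc r, ato = to_loc r, aguard = map (abs_atom A ds) (guard r),
      aupd = upd r, areset = reset r\<rparr>"

definition abs_of_ta :: "('l, 'x, 'p::finite) ta \<Rightarrow> 'p threshold list \<Rightarrow> ('l, 'x) abs_ta" where
  "abs_of_ta A ds =
     \<lparr>ainitial = initial_locs A, arules = abs_of_rule A ds ` rules A, atop = length ds - 1\<rparr>"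

definition aguard_sat :: "('x \<Rightarrow> nat) \<Rightarrow> ('x \<times> nat set) list \<Rightarrow> bool" where
  "aguard_sat h \<phi> \<longleftrightarrow> (\<forall>(x, C)\<in>set \<phi>. \<exists>c\<in>C. h x = c)"


section \<open>The (0,1)-counter system\<close>

record ('l, 'x) zconfig =
  kz :: "'l \<Rightarrow> nat"
  gz :: "'x \<Rightarrow> nat"

definition zcs_configs :: "('l, 'x) abs_ta \<Rightarrow> ('l, 'x) zconfig set" where
  "zcs_configs B = {s. (\<forall>l. kz s l \<in> {0, 1}) \<and> (\<forall>x. gz s x \<le> atop B)}"

definition zcs_init :: "('l, 'x) abs_ta \<Rightarrow> ('l, 'x) zconfig set" where
  "zcs_init B =
     {s \<in> zcs_configs B. (\<forall>x. gz s x = 0) \<and> (\<forall>l. kz s l = 1 \<longrightarrow> l \<in> ainitial B)}"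

text \<open>Possible changes of the interval index for an update \<open>u\<close>; the last index is \<open>m\<close>.\<close>

definition interval_step :: "nat \<Rightarrow> int \<Rightarrow> nat \<Rightarrow> nat \<Rightarrow> bool" where
  "interval_step m u c c' \<longleftrightarrow>
     (u = 0 \<longrightarrow> c' = c) \<and>
     (u = 1 \<longrightarrow> (c' = c \<and> c \<noteq> 0) \<or> (c' = Suc c \<and> c < m)) \<and>
     (u = -1 \<longrightarrow> c' = c \<or> (c \<noteq> 0 \<and> c' = c - 1))"

definition zcs_trans :: "('l, 'x) abs_ta \<Rightarrow>
    (('l, 'x) zconfig \<times> ('l, 'x) abs_rule \<times> ('l, 'x) zconfig) set" where
  "zcs_trans B = {(s, r, s').
     s \<in> zcs_configs B \<and> r \<in> arules B \<and> s' \<in> zcs_configs B \<and>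
     aguard_sat (gz s) (aguard r) \<and>
     kz s (afrom r) = 1 \<and> kz s' (afrom r) \<in> {0, 1} \<and> kz s' (ato r) = 1 \<and>
     (\<forall>l. l \<noteq> afrom r \<and> l \<noteq> ato r \<longrightarrow> kz s' l = kz s l) \<and>
     (\<forall>x. if x \<in> areset r then gz s' x = 0
          else interval_step (atop B) (aupd r x) (gz s x) (gz s' x))}"

definition zcs_path ::
    "('l, 'x) abs_ta \<Rightarrow> (('l, 'x) zconfig, ('l, 'x) abs_rule) path \<Rightarrow> bool" where
  "zcs_path B = is_path (zcs_init B) (zcs_trans B)"

definition ERR :: "('l, 'x) abs_ta \<Rightarrow> 'l set \<Rightarrow> 'l set \<Rightarrow> ('l, 'x) zconfig set" where
  "ERR B Lzero Lpos =
     {s \<in> zcs_configs B. (\<forall>l\<in>Lzero. kz s l = 0) \<and> (\<forall>l\<in>Lpos. kz s l = 1)}"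


section \<open>Non-spurious paths\<close>

text \<open>\<open>\<sigma> i\<close> is the configuration reached after the first \<open>i\<close> blocks of the concrete path whose rule
  sequence consists of blocks of \<open>cs ! i\<close> copies of \<open>rs ! i\<close>. Several concrete rules may have the
  same abstract rule (their guards are then equivalent for all admissible parameters); any of
  them may be used.\<close>

definition non_spurious :: "('l::finite, 'x, 'p::finite) ta \<Rightarrow> 'p threshold list \<Rightarrow>
    (('l, 'x) zconfig, ('l, 'x) abs_rule) path \<Rightarrow> bool" where
  "non_spurious A ds = (\<lambda>(zs, zrs). zcs_path (abs_of_ta A ds) (zs, zrs) \<and>
     (\<exists>ss rs cs \<sigma>.
        length rs = length zrs \<and> length cs = length zrs \<and>
        (\<forall>i<length zrs. rs ! i \<in> rules A \<and> abs_of_rule A ds (rs ! i) = zrs ! i) \<and>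
        cs_path A (ss, concat (map2 replicate cs rs)) \<and>
        (\<forall>i\<le>length zrs. \<sigma> i = ss ! sum_list (take i cs)) \<and>
        (\<forall>i<length zrs. let r = rs ! i; c = cs ! i in
           (from_loc r \<noteq> to_loc r \<longrightarrow>
              kc (\<sigma> i) (from_loc r) = c + kc (\<sigma> (Suc i)) (from_loc r) \<and>
              kc (\<sigma> (Suc i)) (to_loc r) = c + kc (\<sigma> i) (to_loc r)) \<and>
           (\<forall>x. x \<notin> reset r \<longrightarrow> int (gc (\<sigma> (Suc i)) x) = int (gc (\<sigma> i) x) + int c * upd r x) \<and>
           (\<forall>x\<in>reset r. gc (\<sigma> (Suc i)) x = 0) \<and>
           (c > 1 \<longrightarrow>
              guard_sat (\<lambda>x. int (gc (\<sigma> (Suc i)) x) - upd r x) (par (\<sigma> (Suc i))) (guard r))) \<and>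
        (\<forall>i\<le>length zrs. \<forall>x. in_interval ds (par (\<sigma> i)) (gz (zs ! i) x) (gc (\<sigma> i) x)) \<and>
        (\<forall>l. kc (\<sigma> (length zrs)) l > 0 \<longleftrightarrow> kz (zs ! length zrs) l > 0)))"


section \<open>The algorithm PRA\<close>

text \<open>The algorithm is stated for a transition relation \<open>T\<close>, initial states \<open>S0\<close>, error states
  \<open>Err\<close> and a non-spuriousness test \<open>ns\<close>. \<open>None\<close> means that it does not terminate: the unfolding
  of the error graph can be infinite.\<close>

datatype ('s, 'r) answer = Safe | ErrorPath "('s, 'r) path"

text \<open>The state of the backward search consists of \<open>E\<^sub>i\<close>, the union of \<open>E\<^sub>0, \<dots>, E\<^sub>i\<close>, and the
  visited transitions.\<close>

definition backward_search ::
    "('s \<times> 'r \<times> 's) set \<Rightarrow> 's set \<Rightarrow> ('s set \<times> 's set \<times> ('s \<times> 'r \<times> 's) set) option" where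
  "backward_search T Err =
     while_option (\<lambda>(E, S, V). E \<noteq> {})
       (\<lambda>(E, S, V).
          let V' = {(s, r, s') \<in> T. s' \<in> E}; E' = fst ` V' - S
          in (E', S \<union> E', V \<union> V'))
       (Err, Err, {})"

definition error_graph :: "('s \<times> 'r \<times> 's) set \<Rightarrow> 's set \<Rightarrow> ('s \<times> 'r \<times> 's) set" where
  "error_graph V Init =
     {(s, r, s') \<in> V. \<exists>s0\<in>Init. (s0, s) \<in> {(a, b). \<exists>q. (a, q, b) \<in> V}\<^sup>*}"

definition extensions ::
    "('s \<times> 'r \<times> 's) set \<Rightarrow> ('s, 'r) path \<Rightarrow> ('s, 'r) path set" where
  "extensions G = (\<lambda>(ss, rs). {(ss @ [s'], rs @ [r]) | r s'. (last ss, r, s') \<in> G})"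

text \<open>Breadth-first search leaves open the order in which the children of a node of the unfolding
  are visited; it is determined by a function that lists the elements of finite sets.\<close>

definition enumeration :: "('a set \<Rightarrow> 'a list) \<Rightarrow> bool" where
  "enumeration enum \<longleftrightarrow> (\<forall>S. finite S \<longrightarrow> set (enum S) = S \<and> distinct (enum S))"

text \<open>The state of the forward search consists of the queue of paths of the unfolding still to be
  processed and of the non-spurious error path, if one has been found.\<close>

definition forward_search ::
    "('s \<times> 'r \<times> 's) set \<Rightarrow> 's set \<Rightarrow> 's set \<Rightarrow> (('s, 'r) path \<Rightarrow> bool) \<Rightarrow>
     (('s, 'r) path set \<Rightarrow> ('s, 'r) path list) \<Rightarrow> ('s, 'r) answer option" where
  "forward_search G Init Err ns enum =
     map_option (\<lambda>(Q, res). case res of None \<Rightarrow> Safe | Some \<pi> \<Rightarrow> ErrorPath \<pi>)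
       (while_option (\<lambda>(Q, res). Q \<noteq> [] \<and> res = None)
          (\<lambda>(Q, res). let \<pi> = hd Q in
             if last (fst \<pi>) \<in> Err \<and> ns \<pi> then (tl Q, Some \<pi>)
             else (tl Q @ enum (extensions G \<pi>), None))
          (enum ((\<lambda>s. ([s], [])) ` Init), None))"

definition PRA ::
    "('s \<times> 'r \<times> 's) set \<Rightarrow> 's set \<Rightarrow> 's set \<Rightarrow> (('s, 'r) path \<Rightarrow> bool) \<Rightarrow>
     (('s, 'r) path set \<Rightarrow> ('s, 'r) path list) \<Rightarrow> ('s, 'r) answer option" where
  "PRA T S0 Err ns enum =
     (case backward_search T Err of
        None \<Rightarrow> None
      | Some (E, S, V) \<Rightarrow>
          if S \<inter> S0 = {} then Some Safe
          else forward_search (error_graph V (S \<inter> S0)) (S \<inter> S0) Err ns enum)"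

definition error_path ::
    "('s \<times> 'r \<times> 's) set \<Rightarrow> 's set \<Rightarrow> 's set \<Rightarrow> ('s, 'r) path \<Rightarrow> bool" where
  "error_path T S0 Err \<pi> \<longleftrightarrow> is_path S0 T \<pi> \<and> last (fst \<pi>) \<in> Err"

end

theory Submission
  imports Defs "HOL-Library.FuncSet"
begin

text \<open>Concrete paths and abstract paths correspond: mapping a configuration to the support of its
  location counters and to the intervals of its shared variables turns a path of the counter system
  into a path of the (0,1)-counter system that is non-spurious with all acceleration factors equal
  to 1. Conversely, the concretization of a non-spurious error path ends in an error
  configuration. The backward search terminates because the abstract system is finite, and its
  error graph contains every error path. The forward search may diverge, but being breadth-first it
  dequeues each path of the error graph after finitely many steps, unless it stops before.\<close>

section \<open>Abstraction of counter system paths\<close>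

text \<open>Rounding a threshold up, and negative values to 0, is invisible to natural numbers, so
  rational comparisons can be replaced by comparisons of cut points.\<close>

lemma cut_le_iff: "cut t p \<le> n \<longleftrightarrow> lin_eval t p \<le> of_nat n"
proof -
  have "cut t p \<le> n \<longleftrightarrow> \<lceil>lin_eval t p\<rceil> \<le> int n"
    unfolding cut_def by linarith
  then show ?thesis
    by (simp add: ceiling_le_iff)
qed

lemma in_interval_iff_cut:
  "in_interval ds p c n \<longleftrightarrow>
     c < length ds \<and> cut (ds ! c) p \<le> n \<and> (Suc c < length ds \<longrightarrow> n < cut (ds ! Suc c) p)"
  unfolding in_interval_def cut_le_iff[symmetric] not_le[symmetric] by blast

context
  fixes A :: "('l, 'x, 'p::finite) ta"
    and ds :: "'p threshold list"
    and p :: "'p \<Rightarrow> nat"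
  assumes order: "threshold_order A ds"
    and p: "p \<in> params A"
begin

lemma cut_strict_mono: "i < j \<Longrightarrow> j < length ds \<Longrightarrow> cut (ds ! i) p < cut (ds ! j) p"
  using order p unfolding threshold_order_def by blast

lemma cut_mono: "i \<le> j \<Longrightarrow> j < length ds \<Longrightarrow> cut (ds ! i) p \<le> cut (ds ! j) p"
  using cut_strict_mono[of i j] by (cases "i = j") auto

lemma cut_first: "cut (ds ! 0) p = 0" "cut (ds ! 1) p = 1" and length_ds: "length ds \<ge> 2"
  using order by (auto simp: threshold_order_def cut_def lin_eval_def)

lemma in_interval_exists: "\<exists>c. in_interval ds p c n"
proof -
  \<comment> \<open>The wanted index is the largest one whose cut point is at most \<open>n\<close>;
    the set contains 0 because \<open>d_0\<close> has cut point 0.\<close>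
  let ?C = "{c. c < length ds \<and> cut (ds ! c) p \<le> n}"
  have "0 \<in> ?C"
    using cut_first length_ds by auto
  moreover have fin: "finite ?C"
    by simp
  ultimately have max: "Max ?C \<in> ?C"
    by (intro Max_in) auto
  have "\<not> cut (ds ! Suc (Max ?C)) p \<le> n" if "Suc (Max ?C) < length ds"
    using Max_ge[OF fin, of "Suc (Max ?C)"] that by (metis (mono_tags, lifting) mem_Collect_eq not_less_eq_eq order_refl)
  with max show ?thesis
    unfolding in_interval_iff_cut by (intro exI[of _ "Max ?C"]) auto
qed

text \<open>Cut points increase strictly with the index, and the cut point after \<open>c\<close>
  exceeds \<open>n\<close>. Comparing a value with a threshold thus becomes comparing indices, as
  the abstract guards do.\<close>

lemma cut_le_iff_index_le:
  assumes "in_interval ds p c n" and "j < length ds"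
  shows "cut (ds ! j) p \<le> n \<longleftrightarrow> j \<le> c"
proof
  assume "cut (ds ! j) p \<le> n"
  then show "j \<le> c"
    using assms cut_mono[of "Suc c" j] unfolding in_interval_iff_cut by linarith
next
  assume "j \<le> c"
  then show "cut (ds ! j) p \<le> n"
    using assms cut_mono[of j c] unfolding in_interval_iff_cut by linarith
qed

lemma interval_index_mono:
  assumes "in_interval ds p c n" and "in_interval ds p c' n'" and "n \<le> n'"
  shows "c \<le> c'"
proof -
  have "c < length ds" "cut (ds ! c) p \<le> n'"
    using assms unfolding in_interval_iff_cut by auto
  then show ?thesis
    using cut_le_iff_index_le[OF assms(2)] by blast
qed

text \<open>Cut points are distinct natural numbers, so at most one of them is greater than
  \<open>n\<close> and at most \<open>Suc n\<close>: an increment cannot skip an interval.\<close>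

lemma interval_index_Suc:
  assumes "in_interval ds p c n" and "in_interval ds p c' (Suc n)"
  shows "c' = c \<and> c \<noteq> 0 \<or> c' = Suc c \<and> Suc c < length ds"
proof -
  have c': "c' < length ds" "cut (ds ! c') p \<le> Suc n"
    using assms(2) unfolding in_interval_iff_cut by auto
  have "c \<le> c'"
    using interval_index_mono[OF assms] by simp
  moreover have "c' \<le> Suc c"
  proof (rule ccontr)
    assume "\<not> c' \<le> Suc c"
    then have "cut (ds ! Suc c) p < cut (ds ! c') p" "Suc c < length ds"
      using cut_strict_mono[of "Suc c" c'] c' by auto
    then show False
      using assms(1) c' unfolding in_interval_iff_cut by linarith
  qed
  \<comment> \<open>Since \<open>d_1 = 1\<close>, the interval \<open>I_0\<close> contains only 0.
    Hence an increment always leaves it, which gives the side condition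
    \<open>c \<noteq> 0\<close>.\<close>
  moreover have "1 \<le> c'"
    using cut_le_iff_index_le[OF assms(2), of 1] cut_first length_ds by simp
  ultimately show ?thesis
    using c' by linarith
qed

lemma interval_step_if_in_interval:
  assumes "in_interval ds p c n" and "in_interval ds p c' n'"
    and "int n' = int n + u" and "u \<in> {-1, 0, 1}"
  shows "interval_step (length ds - 1) u c c'"
proof -
  consider "u = 0" "n' = n" | "u = 1" "n' = Suc n" | "u = -1" "n = Suc n'"
    using assms(3,4) by force
  then show ?thesis
  proof cases
    case 1
    then show ?thesis
      using assms interval_index_mono[of c n c' n'] interval_index_mono[of c' n' c n]
      by (simp add: interval_step_def)
  next
    case 2
    then show ?thesis
      using interval_index_Suc[of c n c'] assms by (auto simp: interval_step_def)
  next
    \<comment> \<open>A decrement is an increment read backwards.\<close>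
    case 3
    then show ?thesis
      using interval_index_Suc[of c' n' c] assms by (auto simp: interval_step_def)
  qed
qed

lemma thr_index:
  assumes "t \<in> thresholds A"
  shows "thr_index A ds t < length ds" and "cut t p = cut (ds ! thr_index A ds t) p"
proof -
  let ?P = "\<lambda>j. j < length ds \<and> (\<forall>p\<in>params A. cut t p = cut (ds ! j) p)"
  obtain j where "?P j"
    using order assms unfolding threshold_order_def by blast
  then have "?P (thr_index A ds t)"
    unfolding thr_index_def by (rule LeastI[of ?P])
  then show "thr_index A ds t < length ds" and "cut t p = cut (ds ! thr_index A ds t) p"
    using p by auto
qed

text \<open>Each threshold has the same cut point as the entry of \<open>ds\<close> at its
  \<open>thr_index\<close>, so an atomic guard at \<open>g x\<close> amounts to a comparison of that
  index with \<open>h x\<close>.\<close>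

lemma aguard_sat_abs_of_rule:
  assumes "r \<in> rules A" and g: "guard_sat (\<lambda>x. int (g x)) p (guard r)"
    and h: "\<And>x. in_interval ds p (h x) (g x)"
  shows "aguard_sat h (aguard (abs_of_rule A ds r))"
proof -
  have "case abs_atom A ds a of (x, C) \<Rightarrow> h x \<in> C" if a: "a \<in> set (guard r)" for a
  proof -
    have t: "thr a \<in> thresholds A"
      using a \<open>r \<in> rules A\<close> unfolding thresholds_def by blast
    have sat: "atom_sat (\<lambda>x. int (g x)) p a"
      using a g unfolding guard_sat_def by blast
    have "h x < length ds" for x
      using h unfolding in_interval_def by blast
    moreover have "lin_eval (thr a) p \<le> of_nat (g x) \<longleftrightarrow> thr_index A ds (thr a) \<le> h x" for x
      using cut_le_iff[of "thr a" p "g x"] thr_index[OF t] cut_le_iff_index_le[OF h] by simp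
    ultimately show ?thesis
      using sat by (cases a) (auto simp: not_le[symmetric])
  qed
  then show ?thesis
    by (fastforce simp: aguard_sat_def abs_of_rule_def)
qed

end

section \<open>The abstraction map on configurations and transitions\<close>

text \<open>For admissible parameters the interval indices chosen by \<open>SOME\<close> exist by
  \<open>in_interval_exists\<close> and are unique by \<open>interval_index_mono\<close>.\<close>

definition abs_config ::
    "'p::finite threshold list \<Rightarrow> ('l, 'x, 'p) config \<Rightarrow> ('l, 'x) zconfig" where
  "abs_config ds \<sigma> =
     \<lparr>kz = \<lambda>l. of_bool (kc \<sigma> l > 0), gz = \<lambda>x. SOME c. in_interval ds (par \<sigma>) c (gc \<sigma> x)\<rparr>"

lemma kz_abs_config [simp]: "kz (abs_config ds \<sigma>) l = of_bool (kc \<sigma> l > 0)"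
  by (simp add: abs_config_def)

lemma in_interval_abs_config:
  assumes "threshold_order A ds" and "\<sigma> \<in> configs A"
  shows "in_interval ds (par \<sigma>) (gz (abs_config ds \<sigma>) x) (gc \<sigma> x)"
  using in_interval_exists[OF assms(1), of "par \<sigma>" "gc \<sigma> x"] assms(2)
  by (auto simp: abs_config_def configs_def intro: someI_ex)

lemma abs_config_in_zcs_configs:
  assumes "threshold_order A ds" and "\<sigma> \<in> configs A"
  shows "abs_config ds \<sigma> \<in> zcs_configs (abs_of_ta A ds)"
proof -
  have "gz (abs_config ds \<sigma>) x \<le> length ds - 1" for x
    using in_interval_abs_config[OF assms, of x] unfolding in_interval_def by linarith
  then show ?thesis
    by (simp add: zcs_configs_def abs_of_ta_def)
qed

lemma abs_config_in_zcs_init: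
  assumes "threshold_order A ds" and "\<sigma> \<in> cs_init A"
  shows "abs_config ds \<sigma> \<in> zcs_init (abs_of_ta A ds)"
proof -
  have \<sigma>: "\<sigma> \<in> configs A" "\<And>x. gc \<sigma> x = 0" "\<And>l. kc \<sigma> l > 0 \<Longrightarrow> l \<in> initial_locs A"
    using assms(2) by (auto simp: cs_init_def dest: bspec[OF _ ComplI])
  have p: "par \<sigma> \<in> params A"
    using \<sigma>(1) by (simp add: configs_def)
  have "gz (abs_config ds \<sigma>) x = 0" for x
  proof -
    have "in_interval ds (par \<sigma>) (gz (abs_config ds \<sigma>) x) 0"
      using in_interval_abs_config[OF assms(1) \<sigma>(1), of x] \<sigma>(2) by simp
    \<comment> \<open>The value 0 lies below the cut point 1 of \<open>d_1\<close>, so its index is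
      below 1.\<close>
    then show ?thesis
      using cut_le_iff_index_le[OF assms(1) p, of "gz (abs_config ds \<sigma>) x" 0 1]
        cut_first[OF assms(1) p] length_ds[OF assms(1) p] by simp
  qed
  then show ?thesis
    using \<sigma> abs_config_in_zcs_configs[OF assms(1) \<sigma>(1)] by (simp add: zcs_init_def abs_of_ta_def)
qed

text \<open>The source location may be emptied or stay occupied; \<open>zcs_trans\<close> allows
  both, so the support of the new counters is always a legal successor.\<close>

lemma abs_config_trans:
  assumes "threshold_automaton A" and "threshold_order A ds" and "(\<sigma>, r, \<sigma>') \<in> cs_trans A"
  shows "(abs_config ds \<sigma>, abs_of_rule A ds r, abs_config ds \<sigma>') \<in> zcs_trans (abs_of_ta A ds)"
proof -
  have conf: "\<sigma> \<in> configs A" "\<sigma>' \<in> configs A" and r: "r \<in> rules A"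
    and par: "par \<sigma>' = par \<sigma>" and from_pos: "kc \<sigma> (from_loc r) \<ge> 1"
    and k: "\<And>l. int (kc \<sigma>' l) = int (kc \<sigma> l) - of_bool (l = from_loc r) + of_bool (l = to_loc r)"
    and guard: "guard_sat (\<lambda>x. int (gc \<sigma> x)) (par \<sigma>) (guard r)"
    and g: "\<And>x. if x \<in> reset r then gc \<sigma>' x = 0 else int (gc \<sigma>' x) = int (gc \<sigma> x) + upd r x"
    using assms(3) unfolding cs_trans_def by auto
  have p: "par \<sigma> \<in> params A"
    using conf by (simp add: configs_def)
  note int = in_interval_abs_config[OF assms(2) conf(1)]
  note int' = in_interval_abs_config[OF assms(2) conf(2), unfolded par]
  \<comment> \<open>In a self-loop the counter does not change and is positive by the enabling
    condition; otherwise it has just been incremented.\<close>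
  have to_pos: "kc \<sigma>' (to_loc r) > 0"
    using k[of "to_loc r"] from_pos by (cases "to_loc r = from_loc r") auto
  have other: "kc \<sigma>' l = kc \<sigma> l" if "l \<noteq> from_loc r" "l \<noteq> to_loc r" for l
    using k[of l] that by simp
  have reset: "gz (abs_config ds \<sigma>') x = 0" if "x \<in> reset r" for x
  proof -
    have "in_interval ds (par \<sigma>) (gz (abs_config ds \<sigma>') x) 0"
      using int'[of x] g[of x] that by simp
    then show ?thesis
      using cut_le_iff_index_le[OF assms(2) p, of "gz (abs_config ds \<sigma>') x" 0 1]
        cut_first[OF assms(2) p] length_ds[OF assms(2) p] by simp
  qed
  have step: "interval_step (length ds - 1) (upd r x) (gz (abs_config ds \<sigma>) x)
      (gz (abs_config ds \<sigma>') x)" if "x \<notin> reset r" for x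
    using interval_step_if_in_interval[OF assms(2) p int int'] g[of x] that assms(1) r
    unfolding threshold_automaton_def by auto
  show ?thesis
    unfolding zcs_trans_def
    using abs_config_in_zcs_configs[OF assms(2) conf(1)] abs_config_in_zcs_configs[OF assms(2) conf(2)]
      aguard_sat_abs_of_rule[OF assms(2) p r guard int] r from_pos to_pos other reset step
    by (auto simp: abs_of_ta_def abs_of_rule_def)
qed

section \<open>Concrete paths versus non-spurious abstract paths\<close>

lemma cs_path_configs:
  assumes "cs_path A (ss, rs)" and "i \<le> length rs"
  shows "ss ! i \<in> configs A"
  using assms by (cases i) (auto simp: cs_path_def is_path_def cs_init_def cs_trans_def)

lemma concat_map2_replicate_one: "concat (map2 replicate (replicate (length xs) (Suc 0)) xs) = xs"
  by (induction xs) auto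

text \<open>The given path concretizes its own abstraction. With all factors 1 every block is a
  single transition, so the block equations come from \<open>cs_trans\<close> and the guard
  condition for \<open>c > 1\<close> is vacuous.\<close>

lemma non_spurious_abs_config:
  assumes "threshold_automaton A" and "threshold_order A ds" and path: "cs_path A (ss, rs)"
  shows "non_spurious A ds (map (abs_config ds) ss, map (abs_of_rule A ds) rs)"
proof -
  have len: "length ss = Suc (length rs)" and init: "ss ! 0 \<in> cs_init A"
    and tr: "\<And>i. i < length rs \<Longrightarrow> (ss ! i, rs ! i, ss ! Suc i) \<in> cs_trans A"
    using path by (auto simp: cs_path_def is_path_def)
  have "zcs_path (abs_of_ta A ds) (map (abs_config ds) ss, map (abs_of_rule A ds) rs)"
    using len abs_config_in_zcs_init[OF assms(2) init] abs_config_trans[OF assms(1,2) tr]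
    by (simp add: zcs_path_def is_path_def)
  moreover have "let r = rs ! i; c = replicate (length rs) 1 ! i in
      (from_loc r \<noteq> to_loc r \<longrightarrow>
         kc (ss ! i) (from_loc r) = c + kc (ss ! Suc i) (from_loc r) \<and>
         kc (ss ! Suc i) (to_loc r) = c + kc (ss ! i) (to_loc r)) \<and>
      (\<forall>x. x \<notin> reset r \<longrightarrow> int (gc (ss ! Suc i) x) = int (gc (ss ! i) x) + int c * upd r x) \<and>
      (\<forall>x\<in>reset r. gc (ss ! Suc i) x = 0) \<and>
      (c > 1 \<longrightarrow>
         guard_sat (\<lambda>x. int (gc (ss ! Suc i) x) - upd r x) (par (ss ! Suc i)) (guard r))"
    if "i < length rs" for i
  proof -
    have k: "\<forall>l. int (kc (ss ! Suc i) l) =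
          int (kc (ss ! i) l) - of_bool (l = from_loc (rs ! i)) + of_bool (l = to_loc (rs ! i))"
      and g: "\<forall>x. if x \<in> reset (rs ! i) then gc (ss ! Suc i) x = 0
          else int (gc (ss ! Suc i) x) = int (gc (ss ! i) x) + upd (rs ! i) x"
      using tr[OF that] unfolding cs_trans_def by auto
    show ?thesis
      using that g k[rule_format, of "from_loc (rs ! i)"] k[rule_format, of "to_loc (rs ! i)"]
      by (auto simp: Let_def split: if_splits)
  qed
  moreover have "rs ! i \<in> rules A" if "i < length rs" for i
    using tr[OF that] unfolding cs_trans_def by auto
  ultimately show ?thesis
    unfolding non_spurious_def prod.case
    using path len in_interval_abs_config[OF assms(2) cs_path_configs[OF path]]
    by (intro conjI exI[of _ ss] exI[of _ rs] exI[of _ "replicate (length rs) 1"]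
        exI[of _ "\<lambda>i. ss ! i"])
      (auto simp: concat_map2_replicate_one sum_list_replicate min_def)
qed

lemma is_path_last: "is_path S0 T (ss, rs) \<Longrightarrow> last ss = ss ! length rs"
  by (cases "ss = []") (auto simp: is_path_def last_conv_nth)

lemma is_path_take:
  assumes "is_path S0 T (ss, rs)" and "i \<le> length rs"
  shows "is_path S0 T (take (Suc i) ss, take i rs)"
  using assms by (auto simp: is_path_def)

text \<open>Reachability allows \<open>\<sigma>\<close> anywhere on a path, but the reachability
  clause of \<open>non_spurious\<close> concerns the last configuration. The path is therefore cut
  off right after \<open>\<sigma>\<close>.\<close>

lemma reachable_imp_non_spurious:
  assumes "threshold_automaton A" and "threshold_order A ds" and "reachable A \<sigma>"
  obtains \<pi> where "non_spurious A ds \<pi>" and "last (fst \<pi>) = abs_config ds \<sigma>"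
    and "\<sigma> \<in> configs A"
proof -
  obtain ss rs i where path: "cs_path A (ss, rs)" and i: "i < length ss" "\<sigma> = ss ! i"
    using assms(3) unfolding reachable_def by (metis in_set_conv_nth prod.collapse)
  have len: "length ss = Suc (length rs)"
    using path by (simp add: cs_path_def is_path_def)
  have "cs_path A (take (Suc i) ss, take i rs)"
    using is_path_take path i len unfolding cs_path_def by fastforce
  from non_spurious_abs_config[OF assms(1,2) this] show ?thesis
    using i len cs_path_configs[OF path, of i]
    by (intro that) (auto simp: last_map take_Suc_conv_app_nth)
qed

lemma non_spurious_imp_reachable:
  assumes "non_spurious A ds \<pi>"
  obtains \<sigma> where "reachable A \<sigma>"
    and "\<And>l. kc \<sigma> l > 0 \<longleftrightarrow> kz (last (fst \<pi>)) l > 0"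
proof -
  obtain zs zrs where \<pi>: "\<pi> = (zs, zrs)"
    by (cases \<pi>)
  obtain ss rs cs \<sigma> where zpath: "zcs_path (abs_of_ta A ds) (zs, zrs)"
    and len: "length rs = length zrs" "length cs = length zrs"
    and path: "cs_path A (ss, concat (map2 replicate cs rs))"
    and \<sigma>: "\<forall>i\<le>length zrs. \<sigma> i = ss ! sum_list (take i cs)"
    and pos: "\<forall>l. kc (\<sigma> (length zrs)) l > 0 \<longleftrightarrow> kz (zs ! length zrs) l > 0"
    using assms unfolding \<pi> non_spurious_def prod.case by blast
  \<comment> \<open>The factors add up to the number of concrete steps, so the configuration after
    the last block is at a valid position of \<open>ss\<close>.\<close>
  have "length (concat (map2 replicate cs rs)) = sum_list cs"
    using len(2)[folded len(1)] by (induction cs rs rule: list_induct2) auto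
  then have "length ss = Suc (sum_list cs)"
    using path by (simp add: cs_path_def is_path_def)
  then have "\<sigma> (length zrs) \<in> set ss"
    using \<sigma> len by simp
  then have "reachable A (\<sigma> (length zrs))"
    using path unfolding reachable_def by (metis fst_conv)
  moreover have "last zs = zs ! length zrs"
    using zpath is_path_last unfolding zcs_path_def by blast
  ultimately show ?thesis
    using that pos by (simp add: \<pi>)
qed

section \<open>Completeness of the search\<close>

lemma backward_search_terminates:
  assumes "finite T"
  shows "\<exists>E S V. backward_search T Err = Some (E, S, V)"
proof -
  let ?b = "\<lambda>(E :: 'a set, S :: 'a set, V :: ('a \<times> 'b \<times> 'a) set). E \<noteq> {}"
  let ?c = "\<lambda>(E, S, V).
    let V' = {(s, r, s') \<in> T. s' \<in> E}; E' = fst ` V' - S in (E', S \<union> E', V \<union> V')"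
  \<comment> \<open>A non-empty new layer removes sources of \<open>T\<close> from those not yet
    collected. An empty one leaves the cardinality alone, but the second summand drops from 1 to
    0.\<close>
  let ?m = "\<lambda>(E :: 'a set, S :: 'a set, V :: ('a \<times> 'b \<times> 'a) set).
    2 * card (fst ` T - S) + of_bool (E \<noteq> {})"
  have "?m (?c s) < ?m s" if "?b s" for s
  proof -
    obtain E S V where s: "s = (E, S, V)"
      by (cases s)
    define E' where "E' = fst ` {(s, r, s') \<in> T. s' \<in> E} - S"
    have "E' \<subseteq> fst ` T - S"
      unfolding E'_def by auto
    moreover have "fst ` T - (S \<union> E') = (fst ` T - S) - E'"
      by auto
    ultimately have "card (fst ` T - (S \<union> E')) < card (fst ` T - S)" if "E' \<noteq> {}"
      using that assms by (auto intro!: psubset_card_mono)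
    moreover have "E \<noteq> {}" "?m (?c s) = 2 * card (fst ` T - (S \<union> E')) + of_bool (E' \<noteq> {})"
      using \<open>?b s\<close> by (simp_all add: s E'_def Let_def)
    ultimately show ?thesis
      by (cases "E' = {}") (auto simp: s)
  qed
  then have "\<exists>t. while_option ?b ?c (Err, Err, {}) = Some t"
    by (intro measure_while_option_Some[where P = "\<lambda>_. True" and f = ?m]) auto
  then show ?thesis
    unfolding backward_search_def by auto
qed

lemma backward_search_result:
  assumes "backward_search T Err = Some (E, S, V)"
  shows "Err \<subseteq> S" and "V = {(s, r, s') \<in> T. s' \<in> S}" and "fst ` V \<subseteq> S"
proof -
  \<comment> \<open>The states in \<open>S - E\<close> are those already expanded: all transitions
    into them have been visited. The layer \<open>E\<close> is still pending, and it is empty at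
    exit.\<close>
  let ?P = "\<lambda>(E, S, V). Err \<subseteq> S \<and> E \<subseteq> S \<and> V = {(s, r, s') \<in> T. s' \<in> S - E} \<and> fst ` V \<subseteq> S"
  have "?P (E, S, V)"
    using assms unfolding backward_search_def
    by (rule while_option_rule[rotated]) (auto simp: Let_def image_iff)
  moreover have "E = {}"
    using while_option_stop[OF assms[unfolded backward_search_def]] by simp
  ultimately show "Err \<subseteq> S" and "V = {(s, r, s') \<in> T. s' \<in> S}" and "fst ` V \<subseteq> S"
    by auto
qed

text \<open>The final \<open>S\<close> contains \<open>Err\<close> and is closed under predecessors,
  so membership in \<open>S\<close> spreads from the end of the path to its start. The start state
  then witnesses forward reachability in the graph.\<close>

lemma error_path_in_error_graph:
  assumes "backward_search T Err = Some (E, S, V)" and "error_path T S0 Err (ss, rs)"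
  shows "is_path (S \<inter> S0) (error_graph V (S \<inter> S0)) (ss, rs)"
proof -
  note res = backward_search_result[OF assms(1)]
  have len: "length ss = Suc (length rs)" and init: "ss ! 0 \<in> S0"
    and tr: "\<And>i. i < length rs \<Longrightarrow> (ss ! i, rs ! i, ss ! Suc i) \<in> T" and err: "last ss \<in> Err"
    using assms(2) by (auto simp: error_path_def is_path_def)
  have in_S: "ss ! i \<in> S" if "i \<le> length rs" for i
    using that
  proof (induction rule: inc_induct)
    case base
    have "last ss = ss ! length rs"
      using assms(2) is_path_last unfolding error_path_def by blast
    then show ?case
      using err res(1) by auto
  next
    case (step i)
    then have "(ss ! i, rs ! i, ss ! Suc i) \<in> V"
      using tr res(2) by simp
    then show ?case
      using res(3) by force
  qed
  have in_V: "(ss ! i, rs ! i, ss ! Suc i) \<in> V" if "i < length rs" for i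
    using tr[OF that] in_S[of "Suc i"] that res(2) by simp
  have reach: "(ss ! 0, ss ! i) \<in> {(a, b). \<exists>q. (a, q, b) \<in> V}\<^sup>*" if "i \<le> length rs" for i
    using that
  proof (induction i)
    case (Suc i)
    then show ?case
      using in_V[of i] by (auto intro: rtrancl_into_rtrancl)
  qed simp
  have "ss ! 0 \<in> S \<inter> S0"
    using init in_S by simp
  moreover from this have "(ss ! i, rs ! i, ss ! Suc i) \<in> error_graph V (S \<inter> S0)"
    if "i < length rs" for i
    using in_V[OF that] reach[of i] that unfolding error_graph_def by auto
  ultimately show ?thesis
    using len by (simp add: is_path_def)
qed

section \<open>Breadth-first search in the unfolding\<close>

lemma finite_extensions: "finite G \<Longrightarrow> finite (extensions G \<pi>)"
proof -
  assume "finite G"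
  moreover have "extensions G \<pi> \<subseteq> (\<lambda>(s, r, s'). (fst \<pi> @ [s'], snd \<pi> @ [r])) ` G"
    by (force simp: extensions_def split: prod.splits)
  ultimately show ?thesis
    by (meson finite_imageI finite_subset)
qed

lemma is_path_extensions:
  assumes "is_path S0 G \<pi>" and "\<pi>' \<in> extensions G \<pi>"
  shows "is_path S0 G \<pi>'"
proof -
  obtain ss rs r s' where \<pi>: "\<pi> = (ss, rs)" and \<pi>': "\<pi>' = (ss @ [s'], rs @ [r])"
    and tr: "(last ss, r, s') \<in> G"
    using assms(2) by (auto simp: extensions_def split: prod.splits)
  have len: "length ss = Suc (length rs)"
    using assms(1) by (simp add: \<pi> is_path_def)
  have "last ss = ss ! length rs"
    using assms(1) is_path_last unfolding \<pi> by blast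
  then show ?thesis
    using assms(1) tr len by (auto simp: \<pi> \<pi>' is_path_def nth_append less_Suc_eq)
qed

lemma take_in_extensions:
  assumes "is_path S0 G (ss, rs)" and "i < length rs"
  shows "(take (Suc (Suc i)) ss, take (Suc i) rs) \<in> extensions G (take (Suc i) ss, take i rs)"
  using assms by (auto simp: is_path_def extensions_def take_Suc_conv_app_nth)

text \<open>Loop condition and body of \<open>forward_search\<close>, named so that the loop can be
  studied from an arbitrary queue.\<close>

abbreviation "search_cond \<equiv> \<lambda>(Q, res). Q \<noteq> [] \<and> res = None"

abbreviation "search_step G Err ns enum \<equiv> \<lambda>(Q, res). let \<pi> = hd Q in
  if last (fst \<pi>) \<in> Err \<and> ns \<pi> then (tl Q, Some \<pi>) else (tl Q @ enum (extensions G \<pi>), None)"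

text \<open>The outer induction goes down from the full path to shorter prefixes; the inner one is
  on the part \<open>Q1\<close> of the queue ahead of the prefix. New paths are appended at the end,
  so each step shortens \<open>Q1\<close> unless it finds a path. The path found may differ from the
  given one.\<close>

lemma search_finds_path:
  fixes enum :: "('s, 'r) path set \<Rightarrow> ('s, 'r) path list"
  assumes "finite G" and enum: "enumeration enum" and path: "is_path S0 G (ss, rs)"
    and good: "last ss \<in> Err" "ns (ss, rs)"
    and "i \<le> length rs" and "(take (Suc i) ss, take i rs) \<in> set Q"
  shows "\<exists>Q' \<pi>. while_option search_cond (search_step G Err ns enum) (Q, None) = Some (Q', Some \<pi>)"
  using \<open>i \<le> length rs\<close> \<open>_ \<in> set Q\<close>
proof (induction i arbitrary: Q rule: inc_induct)
  case base
  then obtain Q1 Q2 where "Q = Q1 @ (ss, rs) # Q2"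
    using path by (auto simp: is_path_def dest: split_list)
  then show ?case
  proof (induction Q1 arbitrary: Q Q2)
    case Nil
    then show ?case
      \<comment> \<open>The first unfolding records the path, the second sees the loop condition
        fail.\<close>
      using good by (subst while_option_unfold, subst while_option_unfold) simp
  next
    case (Cons q Q1)
    show ?case
    proof (cases "last (fst q) \<in> Err \<and> ns q")
      case True
      then show ?thesis
        using Cons.prems by (subst while_option_unfold, subst while_option_unfold) simp
    next
      case False
      then show ?thesis
        \<comment> \<open>The children of \<open>q\<close> are appended behind the prefix, hence the
          generalization over \<open>Q2\<close>.\<close>
        using Cons by (subst while_option_unfold) (auto simp: Let_def)
    qed
  qed
next
  case (step i)
  let ?\<pi> = "(take (Suc i) ss, take i rs)"
  obtain Q1 Q2 where "Q = Q1 @ ?\<pi> # Q2"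
    using step.prems by (auto dest: split_list)
  then show ?case
  proof (induction Q1 arbitrary: Q Q2)
    case Nil
    show ?case
    proof (cases "last (fst ?\<pi>) \<in> Err \<and> ns ?\<pi>")
      case True
      then show ?thesis
        using Nil by (subst while_option_unfold, subst while_option_unfold) simp
    next
      case False
      have "set (enum (extensions G ?\<pi>)) = extensions G ?\<pi>"
        using enum finite_extensions[OF \<open>finite G\<close>] unfolding enumeration_def by blast
      \<comment> \<open>Dequeuing the prefix enqueues its children, among them the next longer
        prefix, to which the outer induction hypothesis applies.\<close>
      then have "(take (Suc (Suc i)) ss, take (Suc i) rs) \<in> set (Q2 @ enum (extensions G ?\<pi>))"
        using take_in_extensions[OF path] step.hyps by auto
      from step.IH[OF this] show ?thesis
        using Nil False by (subst while_option_unfold) (auto simp: Let_def)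
    qed
  next
    case (Cons q Q1)
    show ?case
    proof (cases "last (fst q) \<in> Err \<and> ns q")
      case True
      then show ?thesis
        using Cons.prems by (subst while_option_unfold, subst while_option_unfold) simp
    next
      case False
      then show ?thesis
        using Cons by (subst while_option_unfold) (auto simp: Let_def)
    qed
  qed
qed

lemma forward_search_complete:
  assumes "finite G" and "finite Init" and "enumeration enum"
    and path: "is_path Init G (ss, rs)" and "last ss \<in> Err" and "ns (ss, rs)"
  shows "\<exists>\<pi>. forward_search G Init Err ns enum = Some (ErrorPath \<pi>)"
proof -
  have "set (enum ((\<lambda>s. ([s], [])) ` Init)) = (\<lambda>s. ([s], [])) ` Init"
    using assms(2,3) unfolding enumeration_def by blast
  moreover have "take (Suc 0) ss = [ss ! 0]" "ss ! 0 \<in> Init"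
    using path by (auto simp: is_path_def take_Suc_conv_app_nth)
  ultimately have "(take (Suc 0) ss, take 0 rs) \<in> set (enum ((\<lambda>s. ([s], [])) ` Init))"
    by auto
  from search_finds_path[where i = 0 and ns = ns, OF assms(1,3-6) le0 this] show ?thesis
    unfolding forward_search_def by auto
qed

lemma forward_search_sound:
  assumes "finite G" and "finite Init" and enum: "enumeration enum"
    and "forward_search G Init Err ns enum = Some (ErrorPath \<pi>)"
  shows "is_path Init G \<pi>" and "last (fst \<pi>) \<in> Err" and "ns \<pi>"
proof -
  \<comment> \<open>Loop invariant: the queue holds only paths of the graph, and a result is
    recorded only after passing both tests.\<close>
  let ?P = "\<lambda>(Q, res). (\<forall>\<pi>\<in>set Q. is_path Init G \<pi>) \<and>
    (\<forall>\<pi>. res = Some \<pi> \<longrightarrow> is_path Init G \<pi> \<and> last (fst \<pi>) \<in> Err \<and> ns \<pi>)"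
  obtain Q where run: "while_option search_cond (search_step G Err ns enum)
      (enum ((\<lambda>s. ([s], [])) ` Init), None) = Some (Q, Some \<pi>)"
    using assms(4) unfolding forward_search_def by (auto split: option.splits)
  have "?P (search_step G Err ns enum s)" if inv: "?P s" and cond: "search_cond s" for s
  proof -
    obtain q Q res where s: "s = (q # Q, res)"
      using cond by (cases s) (auto simp: neq_Nil_conv)
    have "set (enum (extensions G q)) = extensions G q"
      using enum finite_extensions[OF assms(1)] unfolding enumeration_def by blast
    then show ?thesis
      using inv by (auto simp: s intro: is_path_extensions)
  qed
  moreover have "set (enum ((\<lambda>s. ([s], [])) ` Init)) = (\<lambda>s. ([s], [])) ` Init"
    using assms(2) enum unfolding enumeration_def by blast
  then have "?P (enum ((\<lambda>s. ([s], [])) ` Init), None)"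
    by (auto simp: is_path_def)
  ultimately have "?P (Q, Some \<pi>)"
    by (rule while_option_rule[where P = ?P, OF _ run])
  then show "is_path Init G \<pi>" and "last (fst \<pi>) \<in> Err" and "ns \<pi>"
    by (simp_all only: prod.case option.inject simp_thms)
qed

section \<open>Correctness of the whole algorithm\<close>

lemma is_path_mono: "is_path S0 T \<pi> \<Longrightarrow> S0 \<subseteq> S0' \<Longrightarrow> T \<subseteq> T' \<Longrightarrow> is_path S0' T' \<pi>"
  unfolding is_path_def by (auto split: prod.splits)

lemma PRA_complete:
  assumes "finite T" and "finite S0" and "enumeration enum"
    and "error_path T S0 Err \<pi>" and "ns \<pi>"
  shows "\<exists>\<pi>'. PRA T S0 Err ns enum = Some (ErrorPath \<pi>') \<and> error_path T S0 Err \<pi>' \<and> ns \<pi>'"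
proof -
  obtain ss rs where \<pi>: "\<pi> = (ss, rs)"
    by (cases \<pi>)
  obtain E S V where search: "backward_search T Err = Some (E, S, V)"
    using backward_search_terminates[OF assms(1)] by blast
  let ?I = "S \<inter> S0"
  let ?G = "error_graph V ?I"
  have "?G \<subseteq> T"
    using backward_search_result(2)[OF search] unfolding error_graph_def by auto
  then have fin: "finite ?G" "finite ?I"
    using assms(1,2) by (auto intro: finite_subset)
  have path: "is_path ?I ?G (ss, rs)"
    using error_path_in_error_graph[OF search] assms(4) unfolding \<pi> .
  \<comment> \<open>The start state of the error path lies in \<open>?I\<close>, which excludes the
    early answer \<open>Safe\<close>.\<close>
  then have "?I \<noteq> {}"
    by (auto simp: is_path_def)
  then have PRA: "PRA T S0 Err ns enum = forward_search ?G ?I Err ns enum"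
    by (simp add: PRA_def search)
  obtain \<pi>' where \<pi>': "forward_search ?G ?I Err ns enum = Some (ErrorPath \<pi>')"
    using forward_search_complete[OF fin assms(3) path, of Err ns] assms(4,5)
    by (auto simp: \<pi> error_path_def)
  note sound = forward_search_sound[OF fin assms(3) \<pi>']
  have "is_path S0 T \<pi>'"
    using is_path_mono[OF sound(1)] \<open>?G \<subseteq> T\<close> by blast
  then show ?thesis
    using PRA \<pi>' sound by (auto simp: error_path_def)
qed

lemma finite_zcs_configs: "finite (zcs_configs (B :: ('l::finite, 'x::finite) abs_ta))"
proof (rule finite_imageD)
  \<comment> \<open>Over the domain \<open>UNIV\<close> extensionality is no restriction, so
    \<open>finite_PiE\<close> bounds the plain function spaces.\<close>
  have "(\<lambda>s. (kz s, gz s)) ` zcs_configs B \<subseteq>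
      (UNIV \<rightarrow>\<^sub>E {0, 1}) \<times> (UNIV \<rightarrow>\<^sub>E {..atop B})"
    by (auto simp: zcs_configs_def) (metis less_irrefl)
  then show "finite ((\<lambda>s. (kz s, gz s)) ` zcs_configs B)"
    by (rule finite_subset) (intro finite_cartesian_product finite_PiE; simp)
  show "inj_on (\<lambda>s. (kz s, gz s)) (zcs_configs B)"
    by (auto intro!: inj_onI)
qed

lemma finite_zcs_trans:
  fixes B :: "('l::finite, 'x::finite) abs_ta"
  assumes "finite (arules B)"
  shows "finite (zcs_trans B)"
proof (rule finite_subset)
  show "zcs_trans B \<subseteq> zcs_configs B \<times> arules B \<times> zcs_configs B"
    by (auto simp: zcs_trans_def)
  show "finite (zcs_configs B \<times> arules B \<times> zcs_configs B)"
    using assms finite_zcs_configs by blast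
qed

theorem corollary3:
  fixes A :: "('l::finite, 'x::finite, 'p::finite) ta"
    and ds :: "'p threshold list"
    and Lzero Lpos :: "'l set"
    and enum :: "(('l, 'x) zconfig, ('l, 'x) abs_rule) path set \<Rightarrow>
                 (('l, 'x) zconfig, ('l, 'x) abs_rule) path list"
  defines "B \<equiv> abs_of_ta A ds"
  assumes "threshold_automaton A"
    and "threshold_order A ds"
    and "enumeration enum"
  shows "(\<exists>\<pi>. PRA (zcs_trans B) (zcs_init B) (ERR B Lzero Lpos) (non_spurious A ds) enum
                = Some (ErrorPath \<pi>) \<and>
              error_path (zcs_trans B) (zcs_init B) (ERR B Lzero Lpos) \<pi> \<and>
              non_spurious A ds \<pi>)
         \<longleftrightarrow>
         (\<exists>\<sigma>. reachable A \<sigma> \<and> (\<forall>l\<in>Lzero. kc \<sigma> l = 0) \<and> (\<forall>l\<in>Lpos. kc \<sigma> l > 0))"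
    (is "?found \<longleftrightarrow> ?reach")
proof
  assume ?found
  then obtain \<pi> where ns: "non_spurious A ds \<pi>" and err: "last (fst \<pi>) \<in> ERR B Lzero Lpos"
    unfolding error_path_def by blast
  obtain \<sigma> where \<sigma>: "reachable A \<sigma>" "\<And>l. kc \<sigma> l > 0 \<longleftrightarrow> kz (last (fst \<pi>)) l > 0"
    using non_spurious_imp_reachable[OF ns] by blast
  have "kc \<sigma> l = 0" if "l \<in> Lzero" for l
    using err \<sigma>(2)[of l] that by (simp add: ERR_def)
  moreover have "kc \<sigma> l > 0" if "l \<in> Lpos" for l
    using err \<sigma>(2)[of l] that by (simp add: ERR_def)
  ultimately show ?reach
    using \<sigma>(1) by blast
next
  assume ?reach
  then obtain \<sigma> where \<sigma>: "reachable A \<sigma>" "\<forall>l\<in>Lzero. kc \<sigma> l = 0" "\<forall>l\<in>Lpos. kc \<sigma> l > 0"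
    by blast
  obtain \<pi> where \<pi>: "non_spurious A ds \<pi>" "last (fst \<pi>) = abs_config ds \<sigma>" "\<sigma> \<in> configs A"
    using reachable_imp_non_spurious[OF assms(2,3) \<sigma>(1)] .
  \<comment> \<open>The abstraction keeps the support of the counters, so zero and positive counters
    become the values 0 and 1 that \<open>ERR\<close> asks for.\<close>
  have "abs_config ds \<sigma> \<in> ERR B Lzero Lpos"
    using \<sigma> abs_config_in_zcs_configs[OF assms(3) \<pi>(3)] by (simp add: ERR_def B_def)
  moreover have "zcs_path B \<pi>"
    using \<pi>(1) by (auto simp: non_spurious_def B_def)
  ultimately have "error_path (zcs_trans B) (zcs_init B) (ERR B Lzero Lpos) \<pi>"
    using \<pi>(2) by (simp add: error_path_def zcs_path_def)
  moreover have "finite (zcs_trans B)"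
    using assms(2) by (intro finite_zcs_trans) (simp add: B_def abs_of_ta_def threshold_automaton_def)
  moreover have "finite (zcs_init B)"
    using finite_zcs_configs[of B] by (rule rev_finite_subset) (auto simp: zcs_init_def)
  ultimately show ?found
    using PRA_complete[where ns = "non_spurious A ds", OF _ _ assms(4)] \<pi>(1) by blast
qed

end
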